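(* Let $q$ be a prime power and for $n\geq 1$ let $e_n$ be the number of $n\times n$ linear derangements over $\mathbf{F}_q$. Then, with $q$ fixed, the asymptotic probability that an invertible matrix is a linear derangement is $$\lim_{n \to \infty} \frac{e_n}{\gamma_n} = \prod_{r \geq 1}\left(1 - \frac{1}{q^r} \right),$$ and the asymptotic probability that any $n\times n$ matrix is a linear derangement is $$\lim_{n \to \infty} \frac{e_n}{q^{n^2}} = \prod_{r \geq 1}\left(1 - \frac{1}{q^r} \right)^2 .$$
   Context: $\mathbf{F}_q$ is the field with $q$ elements. $\gamma_n=|\mathrm{GL}_n(q)|=(q^n-1)(q^n-q)\cdots(q^n-q^{n-1})$ is the order of the group of invertible $n\times n$ matrices over $\mathbf{F}_q$. A square matrix over $\mathbf{F}_q$ is a linear derangement if it is invertible and fixes no non-zero vector (equivalently, neither $0$ nor $1$ is an eigenvalue). *)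

theory Defs
  imports
    "HOL-Analysis.Infinite_Products"
    "HOL-Number_Theory.Prime_Powers"
    "Jordan_Normal_Form.Matrix"
begin

definition linear_derangement :: "'a :: field mat \<Rightarrow> bool" where
  "linear_derangement A \<longleftrightarrow>
     invertible_mat A \<and>
     (\<forall>v \<in> carrier_vec (dim_col A). A *\<^sub>v v = v \<longrightarrow> v = 0\<^sub>v (dim_col A))"

definition GL :: "nat \<Rightarrow> 'a :: field mat set" where
  "GL n = {A \<in> carrier_mat n n. invertible_mat A}"

definition linear_derangements :: "nat \<Rightarrow> 'a :: field mat set" where
  "linear_derangements n = {A \<in> carrier_mat n n. linear_derangement A}"

end

theory Submission
  imports Defs "Berlekamp_Zassenhaus.Berlekamp_Type_Based"
begin

text \<open>
  The proof computes how the number of fixed vectors of a random invertible matrix is distributed,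
  by the method of moments. For an \<open>n \<times> n\<close> matrix \<open>A\<close> over a field with \<open>q\<close> elements, let \<open>N(A)\<close> be
  the number of vectors fixed by \<open>A\<close>. A linearly independent \<open>k\<close>-tuple of fixed vectors, a fixed
  frame, is an injective \<open>n \<times> k\<close> matrix \<open>X\<close> with \<open>A * X = X\<close>. The range of a frame consists of \<open>q ^ k\<close>
  fixed vectors, and the vectors that extend the frame are the other fixed vectors. Hence \<open>A\<close> has
  \<open>(N(A) - 1) * (N(A) - q) * \<dots> * (N(A) - q ^ (k - 1))\<close> fixed frames of length \<open>k\<close>
  (lemma \<open>card_fixed_frames\<close>). There are none of length \<open>n + 1\<close>, so \<open>N(A)\<close> is one of
  \<open>1, q, \<dots>, q ^ n\<close>.

  For \<open>k \<le> n\<close>, an invertible matrix has on average exactly one fixed frame of length \<open>k\<close>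
  (lemma \<open>sum_card_fixed_frames\<close>). Indeed, if \<open>P\<close> is invertible with last columns \<open>X\<close>, then
  \<open>A \<mapsto> A * P\<close> maps the invertible matrices fixing \<open>X\<close> bijectively to those with last columns \<open>X\<close>,
  and each invertible matrix has exactly one block of last \<open>k\<close> columns.

  The indicator of \<open>N(A) = 1\<close> is a combination of the numbers of fixed frames with coefficients
  \<open>(-1) ^ k / ((q - 1) * (q ^ 2 - 1) * \<dots> * (q ^ k - 1))\<close> (lemmas \<open>alternating_q_sum\<close> and
  \<open>prod_card_fixed_vecs_eq_indicator\<close>). So the proportion of linear derangements among the invertible
  matrices is the sum of these coefficients for \<open>k \<le> n\<close>. As \<open>n\<close> grows it tends to an infinite series,
  which an identity of Euler evaluates as the product of the factors \<open>1 - 1 / q ^ r\<close>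
  (lemma \<open>euler_product_tendsto\<close>). The density of the invertible matrices among all matrices is the
  product of the first \<open>n\<close> of the same factors, whence the square in the second limit.
\<close>

(* Here the dollar sign is reserved for the entries of vectors of variable dimension. *)
unbundle no vec_syntax

section \<open>Columns of matrices\<close>

text \<open>
  Columns are added in front, so that a coefficient vector for the extended matrix is a \<open>vCons\<close> and
  its product with a row splits by the rule for \<open>vCons\<close>.
\<close>

definition cons_col :: "'a vec \<Rightarrow> 'a mat \<Rightarrow> 'a mat" where
  "cons_col v X = mat (dim_row X) (Suc (dim_col X)) (\<lambda>(i, j). if j = 0 then v $ i else X $$ (i, j - 1))"

definition last_cols :: "nat \<Rightarrow> 'a mat \<Rightarrow> 'a mat" where
  "last_cols k X = mat (dim_row X) k (\<lambda>(i, j). X $$ (i, j + (dim_col X - k)))"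

lemma cons_col_carrier [simp]: "X \<in> carrier_mat n k \<Longrightarrow> cons_col v X \<in> carrier_mat n (Suc k)"
  by (simp add: cons_col_def)

lemma row_cons_col: "i < dim_row X \<Longrightarrow> row (cons_col v X) i = vCons (v $ i) (row X i)"
  by (rule eq_vecI) (auto simp: cons_col_def vec_index_vCons)

lemma cons_col_mult_vCons:
  fixes v :: "'a :: field vec"
  assumes "X \<in> carrier_mat n k" "v \<in> carrier_vec n" "c \<in> carrier_vec k"
  shows "cons_col v X *\<^sub>v vCons a c = a \<cdot>\<^sub>v v + X *\<^sub>v c"
proof (rule eq_vecI)
  show "dim_vec (cons_col v X *\<^sub>v vCons a c) = dim_vec (a \<cdot>\<^sub>v v + X *\<^sub>v c)"
    using assms by (simp add: cons_col_def)
  fix i assume "i < dim_vec (a \<cdot>\<^sub>v v + X *\<^sub>v c)"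
  then have "i < n" using assms by simp
  moreover have "dim_row (cons_col v X) = n" using assms by (simp add: cons_col_def)
  ultimately show "(cons_col v X *\<^sub>v vCons a c) $ i = (a \<cdot>\<^sub>v v + X *\<^sub>v c) $ i"
    using assms by (auto simp: row_cons_col mult.commute)
qed

lemma cons_col_inject:
  assumes "X \<in> carrier_mat n k" "Y \<in> carrier_mat n k" "v \<in> carrier_vec n" "w \<in> carrier_vec n"
    and eq: "cons_col v X = cons_col w Y"
  shows "v = w \<and> X = Y"
proof
  show "v = w"
  proof (rule eq_vecI)
    show "dim_vec v = dim_vec w" using assms by simp
    fix i assume "i < dim_vec w"
    then show "v $ i = w $ i"
      using arg_cong[OF eq, of "\<lambda>Z. Z $$ (i, 0)"] assms by (simp add: cons_col_def)
  qed
  show "X = Y"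
  proof (rule eq_matI)
    show "dim_row X = dim_row Y" "dim_col X = dim_col Y" using assms by auto
    fix i j assume "i < dim_row Y" "j < dim_col Y"
    then show "X $$ (i, j) = Y $$ (i, j)"
      using arg_cong[OF eq, of "\<lambda>Z. Z $$ (i, Suc j)"] assms by (simp add: cons_col_def)
  qed
qed

lemma mult_cons_col:
  fixes A :: "'a :: field mat"
  assumes "A \<in> carrier_mat m n" "X \<in> carrier_mat n k" "v \<in> carrier_vec n"
  shows "A * cons_col v X = cons_col (A *\<^sub>v v) (A * X)"
proof (rule eq_matI)
  fix i j assume "i < dim_row (cons_col (A *\<^sub>v v) (A * X))" "j < dim_col (cons_col (A *\<^sub>v v) (A * X))"
  then have ij: "i < m" "j < Suc k" using assms by (auto simp: cons_col_def)
  have "col (cons_col v X) j = (if j = 0 then v else col X (j - 1))"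
    using ij assms by (intro eq_vecI) (auto simp: cons_col_def)
  then show "(A * cons_col v X) $$ (i, j) = cons_col (A *\<^sub>v v) (A * X) $$ (i, j)"
    using ij assms by (auto simp: cons_col_def)
qed (use assms in \<open>auto simp: cons_col_def\<close>)

lemma eq_cons_col_last_cols:
  assumes "X \<in> carrier_mat n (Suc k)"
  shows "X = cons_col (col X 0) (last_cols k X)"
  by (rule eq_matI) (use assms in \<open>auto simp: cons_col_def last_cols_def\<close>)

lemma last_cols_carrier [simp]: "X \<in> carrier_mat n m \<Longrightarrow> last_cols k X \<in> carrier_mat n k"
  by (simp add: last_cols_def)

lemma last_cols_self: "X \<in> carrier_mat n k \<Longrightarrow> last_cols k X = X"
  by (rule eq_matI) (auto simp: last_cols_def)

lemma last_cols_last_cols: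
  "X \<in> carrier_mat n (Suc m) \<Longrightarrow> k \<le> m \<Longrightarrow> last_cols k (last_cols m X) = last_cols k X"
  by (rule eq_matI) (auto simp: last_cols_def Suc_diff_le)

lemma last_cols_cons_col:
  "X \<in> carrier_mat n m \<Longrightarrow> k \<le> m \<Longrightarrow> last_cols k (cons_col v X) = last_cols k X"
  by (rule eq_matI) (auto simp: last_cols_def cons_col_def Suc_diff_le)

lemma last_cols_mult:
  fixes A :: "'a :: field mat"
  assumes "A \<in> carrier_mat l n" "X \<in> carrier_mat n m" "k \<le> m"
  shows "last_cols k (A * X) = A * last_cols k X"
proof (rule eq_matI)
  fix i j assume "i < dim_row (A * last_cols k X)" "j < dim_col (A * last_cols k X)"
  then have ij: "i < l" "j < k" using assms by (auto simp: last_cols_def)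
  have "col (last_cols k X) j = col X (j + (m - k))"
    using ij assms by (intro eq_vecI) (auto simp: last_cols_def)
  then show "last_cols k (A * X) $$ (i, j) = (A * last_cols k X) $$ (i, j)"
    using ij assms by (auto simp: last_cols_def)
qed (use assms in \<open>auto simp: last_cols_def\<close>)

lemma mult_mat_zero_vec:
  fixes A :: "'a :: field mat"
  shows "A \<in> carrier_mat m n \<Longrightarrow> A *\<^sub>v 0\<^sub>v n = 0\<^sub>v m"
  by (rule eq_vecI) auto

section \<open>Injective matrices and invertibility\<close>

definition injective_mats :: "nat \<Rightarrow> nat \<Rightarrow> 'a :: field mat set" where
  "injective_mats n k = {X \<in> carrier_mat n k. inj_on ((*\<^sub>v) X) (carrier_vec k)}"

lemma injective_matsI:
  "X \<in> carrier_mat n k \<Longrightarrow> inj_on ((*\<^sub>v) X) (carrier_vec k) \<Longrightarrow> X \<in> injective_mats n k"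
  by (simp add: injective_mats_def)

lemma injective_mats_inj: "X \<in> injective_mats n k \<Longrightarrow> inj_on ((*\<^sub>v) X) (carrier_vec k)"
  by (simp add: injective_mats_def)

lemma injective_mats_carrier [simp]: "X \<in> injective_mats n k \<Longrightarrow> X \<in> carrier_mat n k"
  by (simp add: injective_mats_def)

text \<open>
  The step that builds frames one vector at a time: a tuple of vectors stays independent exactly when
  the new vector lies outside the span of the others, which is the range of the matrix.
\<close>

lemma cons_col_in_injective_mats_iff:
  fixes v :: "'a :: field vec"
  assumes X: "X \<in> carrier_mat n k" and v: "v \<in> carrier_vec n"
  shows "cons_col v X \<in> injective_mats n (Suc k) \<longleftrightarrow>
    X \<in> injective_mats n k \<and> v \<notin> (*\<^sub>v) X ` carrier_vec k"
proof (intro iffI conjI)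
  assume L: "cons_col v X \<in> injective_mats n (Suc k)"
  have inj: "a = b \<and> c = d"
    if "c \<in> carrier_vec k" "d \<in> carrier_vec k" "a \<cdot>\<^sub>v v + X *\<^sub>v c = b \<cdot>\<^sub>v v + X *\<^sub>v d" for a b c d
  proof -
    have "cons_col v X *\<^sub>v vCons a c = cons_col v X *\<^sub>v vCons b d"
      unfolding cons_col_mult_vCons[OF X v that(1)] cons_col_mult_vCons[OF X v that(2)] by (rule that(3))
    from inj_onD[OF injective_mats_inj[OF L] this] have "vCons a c = vCons b d"
      using that(1,2) by simp
    then show ?thesis by simp
  qed
  have "inj_on ((*\<^sub>v) X) (carrier_vec k)"
  proof (rule inj_onI)
    fix c d assume "c \<in> carrier_vec k" "d \<in> carrier_vec k" "X *\<^sub>v c = X *\<^sub>v d"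
    then show "c = d" using inj[of c d 0 0] by simp
  qed
  with X show "X \<in> injective_mats n k" by (rule injective_matsI)
  show "v \<notin> (*\<^sub>v) X ` carrier_vec k"
  proof
    assume "v \<in> (*\<^sub>v) X ` carrier_vec k"
    then obtain c where c: "c \<in> carrier_vec k" "v = X *\<^sub>v c" by auto
    have X0: "X *\<^sub>v 0\<^sub>v k = 0\<^sub>v n" using X by (rule mult_mat_zero_vec)
    then have "(1::'a) \<cdot>\<^sub>v v + X *\<^sub>v 0\<^sub>v k = 0 \<cdot>\<^sub>v v + X *\<^sub>v c"
      unfolding X0 c(2)[symmetric] using v by (intro eq_vecI) simp_all
    from inj[OF _ c(1) this] show False by simp
  qed
next
  assume R: "X \<in> injective_mats n k \<and> v \<notin> (*\<^sub>v) X ` carrier_vec k"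
  have "inj_on ((*\<^sub>v) (cons_col v X)) (carrier_vec (Suc k))"
  proof (rule inj_onI)
    fix x y assume xy: "x \<in> carrier_vec (Suc k)" "y \<in> carrier_vec (Suc k)"
      and eq: "cons_col v X *\<^sub>v x = cons_col v X *\<^sub>v y"
    obtain a c where x: "x = vCons a c" "c \<in> carrier_vec k"
      using xy by (cases x) auto
    obtain b d where y: "y = vCons b d" "d \<in> carrier_vec k"
      using xy by (cases y) auto
    have eq: "a \<cdot>\<^sub>v v + X *\<^sub>v c = b \<cdot>\<^sub>v v + X *\<^sub>v d"
      using eq X v x y by (simp add: cons_col_mult_vCons)
    have comp: "a * v $ i + (X *\<^sub>v c) $ i = b * v $ i + (X *\<^sub>v d) $ i" if "i < n" for i
      using arg_cong[OF eq, of "\<lambda>w. w $ i"] that X v by (simp del: index_mult_mat_vec)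
    have "a = b"
    proof (rule ccontr)
      assume ab: "a \<noteq> b"
      \<comment> \<open>If the coefficients of the new vector differ, the relation can be solved for it.\<close>
      have "v = X *\<^sub>v (inverse (a - b) \<cdot>\<^sub>v (d - c))"
      proof (rule eq_vecI)
        show "dim_vec v = dim_vec (X *\<^sub>v (inverse (a - b) \<cdot>\<^sub>v (d - c)))" using X v by simp
        fix i assume "i < dim_vec (X *\<^sub>v (inverse (a - b) \<cdot>\<^sub>v (d - c)))"
        then have i: "i < n" using X by simp
        have "X *\<^sub>v (inverse (a - b) \<cdot>\<^sub>v (d - c)) = inverse (a - b) \<cdot>\<^sub>v (X *\<^sub>v d - X *\<^sub>v c)"
          using X x y by (simp add: mult_mat_vec[of _ n k] mult_minus_distrib_mat_vec[of _ n k])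
        then have "(X *\<^sub>v (inverse (a - b) \<cdot>\<^sub>v (d - c))) $ i = inverse (a - b) * ((X *\<^sub>v d) $ i - (X *\<^sub>v c) $ i)"
          using X i by (simp del: index_mult_mat_vec)
        also have "(X *\<^sub>v d) $ i - (X *\<^sub>v c) $ i = (a - b) * v $ i"
          using comp[OF i] by (simp add: algebra_simps)
        finally show "v $ i = (X *\<^sub>v (inverse (a - b) \<cdot>\<^sub>v (d - c))) $ i" using ab by simp
      qed
      then show False using R x y by auto
    qed
    moreover have "X *\<^sub>v c = X *\<^sub>v d"
      using comp \<open>a = b\<close> X by (intro eq_vecI) (auto simp del: index_mult_mat_vec)
    moreover have "inj_on ((*\<^sub>v) X) (carrier_vec k)" using R injective_mats_inj by blast
    ultimately show "x = y" using x y by (simp add: inj_on_eq_iff)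
  qed
  then show "cons_col v X \<in> injective_mats n (Suc k)"
    using X by (intro injective_matsI) simp_all
qed

lemma GL_carrier: "A \<in> GL n \<Longrightarrow> A \<in> carrier_mat n n"
  by (simp add: GL_def)

lemma GL_inverse:
  assumes "A \<in> GL n"
  shows "\<exists>B \<in> GL n. A * B = 1\<^sub>m n \<and> B * A = 1\<^sub>m n"
proof -
  have c: "A \<in> carrier_mat n n" using assms by (rule GL_carrier)
  from assms c obtain B where AB: "A * B = 1\<^sub>m n" and BA: "B * A = 1\<^sub>m (dim_row B)"
    by (auto simp: GL_def invertible_mat_def inverts_mat_def)
  have B: "B \<in> carrier_mat n n"
    using arg_cong[OF AB, of dim_col] arg_cong[OF BA, of dim_col] c by auto
  then have "B \<in> GL n"
    using AB BA c by (auto simp: GL_def invertible_mat_def inverts_mat_def)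
  then show ?thesis using AB BA B by auto
qed

text \<open>
  This turns the count of injective square matrices into the order of the general linear group, and
  gives invertible matrices as the end point of extending a frame column by column.
\<close>

lemma injective_mats_square_eq_GL: "injective_mats n n = (GL n :: 'a :: field mat set)"
proof (intro equalityI subsetI)
  fix A :: "'a mat" assume A: "A \<in> injective_mats n n"
  then have c: "A \<in> carrier_mat n n" by simp
  have "v = 0\<^sub>v n" if "v \<in> carrier_vec n" "A *\<^sub>v v = 0\<^sub>v n" for v
  proof -
    have "A *\<^sub>v 0\<^sub>v n = 0\<^sub>v n" using c by (rule mult_mat_zero_vec)
    moreover have "inj_on ((*\<^sub>v) A) (carrier_vec n)" using A by (rule injective_mats_inj)
    ultimately show ?thesis using that by (auto simp: inj_on_def)
  qed
  then have "det A \<noteq> 0" using det_0_iff_vec_prod_zero_field[OF c] by blast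
  from det_non_zero_imp_unit[OF c this, of "()"] c
  show "A \<in> GL n"
    by (auto simp: GL_def invertible_mat_def inverts_mat_def Units_def ring_mat_simps)
next
  fix A :: "'a mat" assume A: "A \<in> GL n"
  then have c: "A \<in> carrier_mat n n" by (simp add: GL_def)
  obtain B where B: "B \<in> carrier_mat n n" and BA: "B * A = 1\<^sub>m n"
    using GL_inverse[OF A] GL_carrier by blast
  have "inj_on ((*\<^sub>v) A) (carrier_vec n)"
  proof (rule inj_on_inverseI[where g = "(*\<^sub>v) B"])
    fix x :: "'a vec" assume x: "x \<in> carrier_vec n"
    show "B *\<^sub>v (A *\<^sub>v x) = x"
      using assoc_mult_mat_vec[OF B c x, symmetric] BA B x by simp
  qed
  with c show "A \<in> injective_mats n n" by (rule injective_matsI)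
qed

section \<open>Frames of fixed vectors\<close>

definition fixed_vecs :: "'a :: field mat \<Rightarrow> 'a vec set" where
  "fixed_vecs A = {v \<in> carrier_vec (dim_row A). A *\<^sub>v v = v}"

definition fixed_frames :: "'a :: field mat \<Rightarrow> nat \<Rightarrow> 'a mat set" where
  "fixed_frames A k = {X \<in> injective_mats (dim_row A) k. A * X = X}"

text \<open>
  If \<open>A * X = X\<close>, then \<open>A\<close> fixes the whole range of \<open>X\<close>; so the admissible new columns are the
  fixed vectors outside that range.
\<close>

lemma fixed_frames_Suc_bij:
  fixes A :: "'a :: {field, finite} mat"
  assumes A: "A \<in> carrier_mat n n"
  shows "bij_betw (\<lambda>(X, v). cons_col v X)
    (SIGMA X:fixed_frames A k. fixed_vecs A - (*\<^sub>v) X ` carrier_vec k) (fixed_frames A (Suc k))"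
  unfolding bij_betw_def
proof
  have "X = Y \<and> v = w"
    if "X \<in> fixed_frames A k" "Y \<in> fixed_frames A k" "v \<in> fixed_vecs A" "w \<in> fixed_vecs A"
      "cons_col v X = cons_col w Y" for X Y v w
  proof -
    have "X \<in> carrier_mat n k" "Y \<in> carrier_mat n k" "v \<in> carrier_vec n" "w \<in> carrier_vec n"
      using that A by (simp_all add: fixed_frames_def fixed_vecs_def)
    from cons_col_inject[OF this that(5)] show ?thesis by simp
  qed
  note inj = this
  show "inj_on (\<lambda>(X, v). cons_col v X)
    (SIGMA X:fixed_frames A k. fixed_vecs A - (*\<^sub>v) X ` carrier_vec k)"
  proof (rule inj_onI)
    fix p q
    assume "p \<in> (SIGMA X:fixed_frames A k. fixed_vecs A - (*\<^sub>v) X ` carrier_vec k)"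
      and "q \<in> (SIGMA X:fixed_frames A k. fixed_vecs A - (*\<^sub>v) X ` carrier_vec k)"
      and eq: "(case p of (X, v) \<Rightarrow> cons_col v X) = (case q of (X, v) \<Rightarrow> cons_col v X)"
    then have "fst p \<in> fixed_frames A k" "fst q \<in> fixed_frames A k"
        "snd p \<in> fixed_vecs A" "snd q \<in> fixed_vecs A"
      by (simp_all add: mem_Times_iff split: prod.splits)
    moreover have "cons_col (snd p) (fst p) = cons_col (snd q) (fst q)"
      using eq by (simp add: case_prod_unfold)
    ultimately show "p = q" using inj by (simp add: prod_eq_iff)
  qed
next
  have ex: "\<exists>X v. Z = cons_col v X \<and> X \<in> fixed_frames A k \<and> v \<in> fixed_vecs A - (*\<^sub>v) X ` carrier_vec k"
    if "Z \<in> fixed_frames A (Suc k)" for Z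
  proof -
    define X v where "X = last_cols k Z" and "v = col Z 0"
    have Z: "Z \<in> injective_mats n (Suc k)" "A * Z = Z"
      using that A by (auto simp: fixed_frames_def)
    have X: "X \<in> carrier_mat n k" unfolding X_def by (rule last_cols_carrier[OF injective_mats_carrier[OF Z(1)]])
    have v: "v \<in> carrier_vec n" using injective_mats_carrier[OF Z(1)] by (auto simp: v_def)
    have ZX: "Z = cons_col v X"
      using eq_cons_col_last_cols[of Z n k] Z(1) by (simp add: X_def v_def)
    then have "cons_col (A *\<^sub>v v) (A * X) = cons_col v X"
      using Z(2) mult_cons_col[OF A X v] by simp
    then have "A *\<^sub>v v = v \<and> A * X = X"
      using A X v by (intro cons_col_inject[of _ n k]) auto
    then show ?thesis
      using ZX Z(1) cons_col_in_injective_mats_iff[OF X v] A v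
      by (auto simp: fixed_frames_def fixed_vecs_def)
  qed
  have mem: "cons_col v X \<in> fixed_frames A (Suc k)"
    if "X \<in> fixed_frames A k" "v \<in> fixed_vecs A - (*\<^sub>v) X ` carrier_vec k" for X v
  proof -
    have X: "X \<in> injective_mats n k" "A * X = X" and v: "v \<in> carrier_vec n" "A *\<^sub>v v = v"
      using that A by (simp_all add: fixed_frames_def fixed_vecs_def)
    have "cons_col v X \<in> injective_mats n (Suc k)"
      using cons_col_in_injective_mats_iff[of X n k v] X v that(2) by simp
    moreover have "A * cons_col v X = cons_col v X"
      using mult_cons_col[of A n n X k v] A X v by simp
    ultimately show ?thesis using A by (simp add: fixed_frames_def)
  qed
  show "(\<lambda>(X, v). cons_col v X) `
    (SIGMA X:fixed_frames A k. fixed_vecs A - (*\<^sub>v) X ` carrier_vec k) = fixed_frames A (Suc k)"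
  proof (intro equalityI image_subsetI subsetI)
    fix p assume "p \<in> (SIGMA X:fixed_frames A k. fixed_vecs A - (*\<^sub>v) X ` carrier_vec k)"
    then show "(case p of (X, v) \<Rightarrow> cons_col v X) \<in> fixed_frames A (Suc k)"
      using mem by (cases p) simp
  next
    fix Z assume "Z \<in> fixed_frames A (Suc k)"
    from ex[OF this] obtain X v where "Z = cons_col v X" "X \<in> fixed_frames A k"
      "v \<in> fixed_vecs A - (*\<^sub>v) X ` carrier_vec k" by blast
    then show "Z \<in> (\<lambda>(X, v). cons_col v X) `
        (SIGMA X:fixed_frames A k. fixed_vecs A - (*\<^sub>v) X ` carrier_vec k)"
      by (intro rev_image_eqI[of "(X, v)"] SigmaI) simp_all
  qed
qed

lemma fixed_frames_0:
  fixes A :: "'a :: field mat"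
  assumes A: "A \<in> carrier_mat n n"
  shows "fixed_frames A 0 = {0\<^sub>m n 0}"
proof -
  have mat0: "X = 0\<^sub>m n 0" if "X \<in> carrier_mat n 0" for X :: "'a mat"
    using that by (intro eq_matI) auto
  have "v = w" if "v \<in> carrier_vec 0" "w \<in> carrier_vec 0" for v w :: "'a vec"
    using that by (intro eq_vecI) auto
  then have "0\<^sub>m n 0 \<in> (injective_mats n 0 :: 'a mat set)"
    by (intro injective_matsI inj_onI) simp_all
  moreover have "A * 0\<^sub>m n 0 = 0\<^sub>m n 0" using A by simp
  ultimately have zero: "0\<^sub>m n 0 \<in> fixed_frames A 0"
    using A by (simp add: fixed_frames_def)
  have only_zero: "X = 0\<^sub>m n 0" if "X \<in> fixed_frames A 0" for X
    using that A by (intro mat0) (simp add: fixed_frames_def)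
  show ?thesis
    by (intro equalityI subsetI) (drule only_zero, simp, simp add: zero)
qed

lemma finite_fixed_vecs: "finite (fixed_vecs (A :: 'a :: {field, finite} mat))"
  by (rule finite_subset[OF _ finite_carrier_vec[of "dim_row A"]]) (auto simp: fixed_vecs_def)

lemma finite_fixed_frames:
  fixes A :: "'a :: {field, finite} mat"
  assumes A: "A \<in> carrier_mat n n"
  shows "finite (fixed_frames A k)"
proof (induction k)
  case 0
  have "fixed_frames A 0 = {0\<^sub>m n 0}" by (rule fixed_frames_0[OF A])
  then show ?case by simp
next
  case (Suc k)
  then have "finite (SIGMA X:fixed_frames A k. fixed_vecs A - (*\<^sub>v) X ` carrier_vec k)"
    by (intro finite_SigmaI finite_Diff finite_fixed_vecs)
  then show ?case
    using bij_betw_finite[OF fixed_frames_Suc_bij[OF A, of k]] by simp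
qed

lemma card_range_injective_mat:
  fixes X :: "'a :: {field, finite} mat"
  assumes "X \<in> injective_mats n k"
  shows "card ((*\<^sub>v) X ` carrier_vec k) = CARD('a) ^ k"
  using injective_mats_inj[OF assms] by (simp add: card_image card_carrier_vec)

text \<open>
  A frame of length \<open>k\<close> excludes exactly the \<open>CARD('a) ^ k\<close> vectors of its span, all of which are
  fixed. The subtraction takes place in the reals, so the formula also covers lengths beyond the
  dimension of the fixed space, where a factor vanishes.
\<close>

lemma card_fixed_frames:
  fixes A :: "'a :: {field, finite} mat"
  assumes A: "A \<in> carrier_mat n n"
  shows "real (card (fixed_frames A k)) =
    (\<Prod>i<k. real (card (fixed_vecs A)) - real CARD('a) ^ i)"
proof (induction k)
  case 0
  show ?case by (simp add: fixed_frames_0[OF A])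
next
  case (Suc k)
  have "card (fixed_vecs A - (*\<^sub>v) X ` carrier_vec k) = card (fixed_vecs A) - CARD('a) ^ k
      \<and> CARD('a) ^ k \<le> card (fixed_vecs A)" if "X \<in> fixed_frames A k" for X
  proof -
    have X: "X \<in> injective_mats n k" "A * X = X" using that A by (auto simp: fixed_frames_def)
    have "(*\<^sub>v) X ` carrier_vec k \<subseteq> fixed_vecs A"
    proof
      fix w assume "w \<in> (*\<^sub>v) X ` carrier_vec k"
      then obtain c where c: "c \<in> carrier_vec k" "w = X *\<^sub>v c" by auto
      have "A *\<^sub>v (X *\<^sub>v c) = X *\<^sub>v c"
        using assoc_mult_mat_vec[OF A injective_mats_carrier[OF X(1)] c(1)] X(2) by simp
      then show "w \<in> fixed_vecs A"
        using c A injective_mats_carrier[OF X(1)] by (auto simp: fixed_vecs_def)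
    qed
    then show ?thesis
      using card_range_injective_mat[OF X(1)] finite_fixed_vecs[of A]
      by (metis card_Diff_subset card_mono finite_subset)
  qed
  note * = this
  have "card (fixed_frames A (Suc k)) =
      card (SIGMA X:fixed_frames A k. fixed_vecs A - (*\<^sub>v) X ` carrier_vec k)"
    using bij_betw_same_card[OF fixed_frames_Suc_bij[OF A]] by simp
  also have "\<dots> = (\<Sum>X\<in>fixed_frames A k. card (fixed_vecs A - (*\<^sub>v) X ` carrier_vec k))"
    using finite_fixed_frames[OF A] finite_fixed_vecs by (intro card_SigmaI) auto
  finally have "real (card (fixed_frames A (Suc k))) =
      (\<Sum>X\<in>fixed_frames A k. real (card (fixed_vecs A - (*\<^sub>v) X ` carrier_vec k)))" by simp
  also have "\<dots> = (\<Sum>X\<in>fixed_frames A k. real (card (fixed_vecs A)) - real CARD('a) ^ k)"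
    using * by (intro sum.cong) (auto simp: of_nat_diff)
  also have "\<dots> = real (card (fixed_frames A k)) * (real (card (fixed_vecs A)) - real CARD('a) ^ k)"
    by simp
  finally show ?case using Suc by simp
qed

lemma fixed_vecs_one: "fixed_vecs (1\<^sub>m n :: 'a :: field mat) = carrier_vec n"
  by (auto simp: fixed_vecs_def)

lemma fixed_frames_one: "fixed_frames (1\<^sub>m n :: 'a :: field mat) k = injective_mats n k"
  using left_mult_one_mat[OF injective_mats_carrier] by (auto simp: fixed_frames_def)

lemma card_injective_mats:
  "real (card (injective_mats n k :: 'a :: {field, finite} mat set)) =
    (\<Prod>i<k. real CARD('a) ^ n - real CARD('a) ^ i)"
  using card_fixed_frames[of "1\<^sub>m n :: 'a mat" n k]
  by (simp add: fixed_vecs_one fixed_frames_one card_carrier_vec)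

lemma finite_injective_mats: "finite (injective_mats n k :: 'a :: {field, finite} mat set)"
  using finite_fixed_frames[of "1\<^sub>m n :: 'a mat" n k] by (simp add: fixed_frames_one)

text \<open>
  The fixed vectors form a subspace, but its dimension need not be introduced: the counting formula
  says that there is no frame of length \<open>n + 1\<close> in the whole space, so there is none fixed by \<open>A\<close>, and
  the same formula for \<open>A\<close> then shows that one of its factors is zero.
\<close>

lemma card_fixed_vecs_power:
  fixes A :: "'a :: {field, finite} mat"
  assumes A: "A \<in> carrier_mat n n"
  shows "\<exists>i\<le>n. card (fixed_vecs A) = CARD('a) ^ i"
proof -
  \<comment> \<open>The factor for \<open>i = n\<close> is \<open>q ^ n - q ^ n\<close>.\<close>
  have "card (injective_mats n (Suc n) :: 'a mat set) = 0"
    using card_injective_mats[where 'a = 'a, of n "Suc n"] by simp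
  then have "injective_mats n (Suc n) = ({} :: 'a mat set)"
    using finite_injective_mats card_0_eq by blast
  then have "fixed_frames A (Suc n) = {}" using A by (auto simp: fixed_frames_def)
  then have "(\<Prod>i\<le>n. real (card (fixed_vecs A)) - real CARD('a) ^ i) = 0"
    using card_fixed_frames[OF A, of "Suc n"] by (simp add: lessThan_Suc_atMost)
  then obtain i where "i \<le> n" "real (card (fixed_vecs A)) = real CARD('a) ^ i"
    by (auto simp: prod_zero_iff)
  then show ?thesis by (metis of_nat_eq_iff of_nat_power)
qed

section \<open>Averaging over the general linear group\<close>

lemma card_field_gt_1: "CARD('a :: {field, finite}) > 1"
proof -
  have "card {0 :: 'a, 1} \<le> CARD('a)" by (intro card_mono) simp_all
  then show ?thesis by simp
qed

text \<open>
  Completion of a frame to a basis, by counting: the range of fewer than \<open>n\<close> columns has too few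
  elements to be the whole space. New columns are added in front, so the given ones remain last.
\<close>

lemma extend_injective_mat:
  fixes X :: "'a :: {field, finite} mat"
  assumes "X \<in> injective_mats n k" "k \<le> m" "m \<le> n"
  shows "\<exists>P \<in> injective_mats n m. last_cols k P = X"
  using assms(2,3)
proof (induction m rule: dec_induct)
  case base
  show ?case using assms(1) last_cols_self[OF injective_mats_carrier[OF assms(1)]] by (intro bexI)
next
  case (step m)
  then obtain P where P: "P \<in> injective_mats n m" "last_cols k P = X" by auto
  have "card ((*\<^sub>v) P ` carrier_vec m) < card (carrier_vec n :: 'a vec set)"
    using step.hyps step.prems card_field_gt_1[where 'a = 'a]
    by (simp add: card_range_injective_mat[OF P(1)] card_carrier_vec)
  then have "\<not> carrier_vec n \<subseteq> (*\<^sub>v) P ` carrier_vec m"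
    using card_mono[of "(*\<^sub>v) P ` carrier_vec m" "carrier_vec n"] by auto
  then obtain v where v: "v \<in> carrier_vec n" "v \<notin> (*\<^sub>v) P ` carrier_vec m" by blast
  then have "cons_col v P \<in> injective_mats n (Suc m)"
    using cons_col_in_injective_mats_iff[OF injective_mats_carrier[OF P(1)] v(1)] P(1) by simp
  moreover have "last_cols k (cons_col v P) = X"
    using last_cols_cons_col[OF injective_mats_carrier[OF P(1)] step.hyps(1)] P(2) by simp
  ultimately show ?case by blast
qed

lemma last_cols_injective:
  assumes "X \<in> injective_mats n m" "k \<le> m"
  shows "last_cols k X \<in> injective_mats n k"
  using assms(2,1)
proof (induction m arbitrary: X rule: dec_induct)
  case base
  then show ?case using last_cols_self[of X n k] by simp
next
  case (step m)
  have X: "X \<in> carrier_mat n (Suc m)" using step.prems by (rule injective_mats_carrier)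
  have "cons_col (col X 0) (last_cols m X) \<in> injective_mats n (Suc m)"
    using step.prems eq_cons_col_last_cols[OF X] by simp
  moreover have "col X 0 \<in> carrier_vec n" using X by auto
  ultimately have "last_cols m X \<in> injective_mats n m"
    using cons_col_in_injective_mats_iff[OF last_cols_carrier[OF X]] by blast
  from step.IH[OF this] show ?case using last_cols_last_cols[OF X step.hyps(1)] by simp
qed

lemma injective_mats_mult:
  assumes "X \<in> injective_mats n m" "Y \<in> injective_mats m k"
  shows "X * Y \<in> injective_mats n k"
proof -
  have c: "X \<in> carrier_mat n m" "Y \<in> carrier_mat m k" using assms by auto
  have "inj_on (\<lambda>v. X *\<^sub>v (Y *\<^sub>v v)) (carrier_vec k)"
  proof (rule inj_onI)
    fix v w assume vw: "v \<in> carrier_vec k" "w \<in> carrier_vec k" "X *\<^sub>v (Y *\<^sub>v v) = X *\<^sub>v (Y *\<^sub>v w)"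
    have "Y *\<^sub>v v = Y *\<^sub>v w"
      by (rule inj_onD[OF injective_mats_inj[OF assms(1)] vw(3)]) (use vw c in simp_all)
    from inj_onD[OF injective_mats_inj[OF assms(2)] this] show "v = w" using vw by simp
  qed
  moreover have "(X * Y) *\<^sub>v v = X *\<^sub>v (Y *\<^sub>v v)" if "v \<in> carrier_vec k" for v
    using c that by (rule assoc_mult_mat_vec)
  ultimately have "inj_on ((*\<^sub>v) (X * Y)) (carrier_vec k)"
    by (simp cong: inj_on_cong)
  with mult_carrier_mat[OF c] show ?thesis by (rule injective_matsI)
qed

lemma GL_mult: "A \<in> GL n \<Longrightarrow> B \<in> GL n \<Longrightarrow> A * B \<in> GL n"
  using injective_mats_mult[of A n n B n] by (simp add: injective_mats_square_eq_GL)

text \<open>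
  Multiplication on the right by an invertible \<open>P\<close> with last columns \<open>X\<close> carries one set to the other,
  since the last columns of \<open>A * P\<close> are \<open>A * X\<close>.
\<close>

lemma card_GL_fixing_frame:
  fixes X :: "'a :: {field, finite} mat"
  assumes X: "X \<in> injective_mats n k" and "k \<le> n"
  shows "card {A \<in> GL n. A * X = X} = card {B \<in> GL n. last_cols k B = X}"
proof -
  obtain P where P: "P \<in> GL n" "last_cols k P = X"
    using extend_injective_mat[OF X assms(2) order_refl] by (auto simp: injective_mats_square_eq_GL)
  obtain Q where Q: "Q \<in> GL n" "P * Q = 1\<^sub>m n" "Q * P = 1\<^sub>m n"
    using GL_inverse[OF P(1)] by blast
  have cancel: "A * P * Q = A" "A * Q * P = A" if "A \<in> GL n" for A
    using assoc_mult_mat[OF GL_carrier[OF that] GL_carrier[OF P(1)] GL_carrier[OF Q(1)]]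
      assoc_mult_mat[OF GL_carrier[OF that] GL_carrier[OF Q(1)] GL_carrier[OF P(1)]]
      right_mult_one_mat[OF GL_carrier[OF that]] Q(2,3) by simp_all
  have last: "last_cols k (A * P) = A * X" if "A \<in> GL n" for A
    using last_cols_mult[OF GL_carrier[OF that] GL_carrier[OF P(1)] assms(2)] P(2) by simp
  have "bij_betw (\<lambda>A. A * P) {A \<in> GL n. A * X = X} {B \<in> GL n. last_cols k B = X}"
  proof (rule bij_betw_byWitness[where f' = "\<lambda>B. B * Q"])
    show "\<forall>A\<in>{A \<in> GL n. A * X = X}. A * P * Q = A" using cancel(1) by simp
    show "\<forall>B\<in>{B \<in> GL n. last_cols k B = X}. B * Q * P = B" using cancel(2) by simp
    show "(\<lambda>A. A * P) ` {A \<in> GL n. A * X = X} \<subseteq> {B \<in> GL n. last_cols k B = X}"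
      using GL_mult[OF _ P(1)] last by auto
    show "(\<lambda>B. B * Q) ` {B \<in> GL n. last_cols k B = X} \<subseteq> {A \<in> GL n. A * X = X}"
    proof (rule image_subsetI, elim CollectE conjE)
      fix B :: "'a mat" assume B: "B \<in> GL n" "last_cols k B = X"
      have BQ: "B * Q \<in> GL n" using B(1) Q(1) by (rule GL_mult)
      have "(B * Q) * X = X" using last[OF BQ] cancel(2)[OF B(1)] B(2) by simp
      with BQ show "B * Q \<in> {A \<in> GL n. A * X = X}" by simp
    qed
  qed
  then show ?thesis by (rule bij_betw_same_card)
qed

text \<open>
  The moment computation: an average of one fixed frame per invertible matrix. Exchanging the order of
  summation leaves, for each frame, the number of invertible matrices ending in it, and these sets
  partition the general linear group. For \<open>k > n\<close> there is no frame at all, hence the bound.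
\<close>

lemma sum_card_fixed_frames:
  assumes "k \<le> n"
  shows "(\<Sum>A\<in>(GL n :: 'a mat set). card (fixed_frames A k)) = card (GL n :: 'a :: {field, finite} mat set)"
proof -
  let ?G = "GL n :: 'a mat set" and ?I = "injective_mats n k :: 'a mat set"
  have fin: "finite ?G" "finite ?I"
    using finite_injective_mats[of n n, where 'a = 'a] finite_injective_mats
    by (auto simp: injective_mats_square_eq_GL)
  have "(\<Sum>A\<in>?G. card (fixed_frames A k)) = (\<Sum>A\<in>?G. card {X \<in> ?I. A * X = X})"
    by (intro sum.cong) (auto simp: fixed_frames_def GL_def)
  also have "\<dots> = (\<Sum>X\<in>?I. card {A \<in> ?G. A * X = X})"
    using fin by (intro sum_multicount_gen) auto
  also have "\<dots> = (\<Sum>X\<in>?I. card {B \<in> ?G. last_cols k B = X})"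
    using card_GL_fixing_frame assms by (intro sum.cong) auto
  also have "\<dots> = card (\<Union>X\<in>?I. {B \<in> ?G. last_cols k B = X})"
    using fin by (intro card_UN_disjoint[symmetric]) auto
  also have "(\<Union>X\<in>?I. {B \<in> ?G. last_cols k B = X}) = ?G"
    using last_cols_injective[of _ n n k] assms by (auto simp: injective_mats_square_eq_GL)
  finally show ?thesis .
qed

section \<open>Inverting the moments\<close>

definition q_denom :: "real \<Rightarrow> nat \<Rightarrow> real" where
  "q_denom q k = (\<Prod>i<k. q ^ Suc i - 1)"

lemma q_denom_Suc: "q_denom q (Suc k) = q_denom q k * (q ^ Suc k - 1)"
  by (simp add: q_denom_def)

lemma q_denom_0: "q_denom q 0 = 1"
  by (simp add: q_denom_def)

lemma q_denom_pos:
  assumes "1 < q"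
  shows "0 < q_denom q k"
proof -
  have "1 < q ^ Suc i" for i using assms by (rule one_less_power) simp
  then show ?thesis unfolding q_denom_def by (intro prod_pos) simp
qed

text \<open>
  A telescoping form of inversion by \<open>q\<close>-binomial coefficients. Both sides are polynomials in \<open>Q\<close> of
  degree \<open>m\<close>; they take the value \<open>1\<close> at \<open>Q = 1\<close> and vanish at \<open>Q = q, \<dots>, q ^ m\<close>. The induction
  works because the next term is the previous partial sum times \<open>(1 - Q) / (q ^ (m + 1) - 1)\<close>.
\<close>

lemma alternating_q_sum:
  assumes "1 < q"
  shows "(\<Sum>k\<le>m. (-1) ^ k * (\<Prod>i<k. Q - q ^ i) / q_denom q k) =
    (\<Prod>j<m. (q ^ Suc j - Q) / (q ^ Suc j - 1))"
proof (induction m)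
  case 0
  show ?case by (simp add: q_denom_0)
next
  case (Suc m)
  define d where "d = q ^ Suc m - 1"
  define p where "p = (\<Prod>j<m. q ^ Suc j - Q)"
  have d: "d \<noteq> 0" using one_less_power[OF assms, of "Suc m"] by (simp add: d_def)
  have D: "q_denom q m \<noteq> 0" using q_denom_pos[OF assms, of m] by simp
  have "(-1) ^ m * (\<Prod>i<m. Q - q ^ Suc i) = p"
    unfolding p_def by (induction m) (simp_all add: algebra_simps)
  moreover have "(\<Prod>i<Suc m. Q - q ^ i) = (Q - 1) * (\<Prod>i<m. Q - q ^ Suc i)"
    by (simp add: prod.lessThan_Suc_shift del: prod.lessThan_Suc)
  moreover have "(-1) ^ Suc m * ((Q - 1) * r) = (1 - Q) * ((-1) ^ m * r)" for r
    by (simp add: algebra_simps)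
  ultimately have num: "(-1) ^ Suc m * (\<Prod>i<Suc m. Q - q ^ i) = (1 - Q) * p"
    by (simp only:)
  have quot: "(\<Prod>j<m. (q ^ Suc j - Q) / (q ^ Suc j - 1)) = p / q_denom q m"
    by (simp add: p_def q_denom_def prod_dividef)
  have "(\<Sum>k\<le>Suc m. (-1) ^ k * (\<Prod>i<k. Q - q ^ i) / q_denom q k) =
      p / q_denom q m + (1 - Q) * p / (q_denom q m * d)"
    using Suc num quot by (simp add: q_denom_Suc d_def del: prod.lessThan_Suc power_Suc)
  also have "\<dots> = p / q_denom q m * ((d + 1 - Q) / d)"
    using d D by (simp add: field_simps)
  also have "\<dots> = (\<Prod>j<Suc m. (q ^ Suc j - Q) / (q ^ Suc j - 1))"
    unfolding prod.lessThan_Suc quot by (simp add: d_def)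
  finally show ?case .
qed

lemma linear_derangements_eq:
  "linear_derangements n = {A \<in> GL n :: 'a :: field mat set. card (fixed_vecs A) = 1}"
proof -
  have "linear_derangement A \<longleftrightarrow> invertible_mat A \<and> card (fixed_vecs A) = 1"
    if A: "A \<in> carrier_mat n n" for A :: "'a mat"
  proof -
    have zero: "0\<^sub>v n \<in> fixed_vecs A"
      using A mult_mat_zero_vec[OF A] by (simp add: fixed_vecs_def)
    have "(\<forall>v \<in> carrier_vec n. A *\<^sub>v v = v \<longrightarrow> v = 0\<^sub>v n) \<longleftrightarrow> fixed_vecs A \<subseteq> {0\<^sub>v n}"
      using A by (auto simp: fixed_vecs_def)
    also have "\<dots> \<longleftrightarrow> fixed_vecs A = {0\<^sub>v n}" using zero by blast
    also have "\<dots> \<longleftrightarrow> card (fixed_vecs A) = 1" using zero by (auto simp: card_1_singleton_iff)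
    finally show ?thesis using A by (simp add: linear_derangement_def)
  qed
  then show ?thesis by (auto simp: linear_derangements_def GL_def)
qed

lemma finite_GL: "finite (GL n :: 'a :: {field, finite} mat set)"
  using finite_injective_mats[of n n, where 'a = 'a] by (simp add: injective_mats_square_eq_GL)

text \<open>
  If \<open>A\<close> fixes a nonzero vector, the number of its fixed vectors is one of \<open>q, \<dots>, q ^ n\<close>, and the
  factor for this power is zero.
\<close>

lemma prod_card_fixed_vecs_eq_indicator:
  fixes A :: "'a :: {field, finite} mat"
  assumes A: "A \<in> carrier_mat n n"
  defines "q \<equiv> real CARD('a)" and "N \<equiv> card (fixed_vecs A)"
  shows "(\<Prod>j<n. (q ^ Suc j - real N) / (q ^ Suc j - 1)) = (if N = 1 then 1 else 0)"
proof (cases "N = 1")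
  case True
  have "1 < q" using card_field_gt_1[where 'a = 'a] by (simp add: q_def)
  then have "q ^ Suc j - 1 \<noteq> 0" for j using one_less_power[of q "Suc j"] by simp
  then show ?thesis using True by (simp del: power_Suc)
next
  case False
  obtain i where i: "i \<le> n" "real N = q ^ i"
    using card_fixed_vecs_power[OF A] unfolding N_def q_def by auto
  with False obtain j where "i = Suc j" by (cases i) auto
  then have "\<exists>j\<in>{..<n}. (q ^ Suc j - real N) / (q ^ Suc j - 1) = 0"
    using i by (intro bexI[of _ j]) auto
  then have "(\<Prod>j<n. (q ^ Suc j - real N) / (q ^ Suc j - 1)) = 0"
    by (intro prod_zero) simp_all
  then show ?thesis using False by simp
qed

text \<open>
  Expand the indicator of having a single fixed vector into numbers of fixed frames; by
  \<open>sum_card_fixed_frames\<close> every such number sums to the order of the group.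
\<close>

lemma card_linear_derangements:
  "real (card (linear_derangements n :: 'a :: {field, finite} mat set)) =
    real (card (GL n :: 'a mat set)) * (\<Sum>k\<le>n. (-1) ^ k / q_denom (real CARD('a)) k)"
proof -
  let ?G = "GL n :: 'a mat set" and ?q = "real CARD('a)"
  have q: "1 < ?q" using card_field_gt_1[where 'a = 'a] by simp
  have indicator: "(if card (fixed_vecs A) = 1 then 1 else 0) =
      (\<Sum>k\<le>n. (-1) ^ k / q_denom ?q k * real (card (fixed_frames A k)))" if "A \<in> ?G" for A
  proof -
    have A: "A \<in> carrier_mat n n" using that by (rule GL_carrier)
    show ?thesis
      unfolding prod_card_fixed_vecs_eq_indicator[OF A, symmetric] alternating_q_sum[OF q, symmetric]
        card_fixed_frames[OF A] by simp
  qed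
  have "real (card (linear_derangements n :: 'a mat set)) =
      (\<Sum>A\<in>?G. if card (fixed_vecs A) = 1 then 1 else 0)"
    unfolding linear_derangements_eq using finite_GL[of n, where 'a = 'a]
    by (simp add: sum.If_cases Int_def)
  also have "\<dots> = (\<Sum>A\<in>?G. \<Sum>k\<le>n. (-1) ^ k / q_denom ?q k * real (card (fixed_frames A k)))"
    by (intro sum.cong refl indicator)
  also have "\<dots> = (\<Sum>k\<le>n. (-1) ^ k / q_denom ?q k * real (\<Sum>A\<in>?G. card (fixed_frames A k)))"
    by (subst sum.swap) (simp only: sum_distrib_left of_nat_sum)
  also have "\<dots> = (\<Sum>k\<le>n. (-1) ^ k / q_denom ?q k * real (card ?G))"
    by (intro sum.cong refl) (simp only: sum_card_fixed_frames atMost_iff)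
  also have "\<dots> = real (card ?G) * (\<Sum>k\<le>n. (-1) ^ k / q_denom ?q k)"
    by (simp only: sum_distrib_left mult.commute)
  finally show ?thesis .
qed

section \<open>Passing to the limit\<close>

lemma euler_summable:
  assumes "2 \<le> q" "\<bar>y\<bar> \<le> 1"
  shows "summable (\<lambda>k. (-1) ^ k / q_denom q k * y ^ k)"
proof (rule summable_ratio_test[where c = "1 / 3" and N = 1])
  fix n :: nat assume n: "1 \<le> n"
  have pos: "0 < q_denom q n" using assms q_denom_pos by simp
  \<comment> \<open>The ratio of consecutive terms is at most \<open>1 / (q ^ (n + 1) - 1)\<close>, hence at most \<open>1 / 3\<close> from \<open>n = 1\<close> on.\<close>
  have "(2::real) ^ 2 \<le> 2 ^ Suc n" using n by (intro power_increasing) auto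
  also have "\<dots> \<le> q ^ Suc n" using assms by (intro power_mono) auto
  finally have ge: "3 \<le> q ^ Suc n - 1" by simp
  have "norm ((-1) ^ Suc n / q_denom q (Suc n) * y ^ Suc n) =
      norm ((-1) ^ n / q_denom q n * y ^ n) * (\<bar>y\<bar> / (q ^ Suc n - 1))"
    using pos ge by (simp add: q_denom_Suc abs_mult power_abs del: power_Suc)
  also have "\<dots> \<le> norm ((-1) ^ n / q_denom q n * y ^ n) * (1 / 3)"
    using ge assms by (intro mult_left_mono frac_le) auto
  finally show "norm ((-1) ^ Suc n / q_denom q (Suc n) * y ^ Suc n)
      \<le> 1 / 3 * norm ((-1) ^ n / q_denom q n * y ^ n)" by (simp add: mult.commute)
qed simp

text \<open>
  Euler's series for the product of the factors \<open>1 - y / q ^ r\<close> over \<open>r \<ge> 1\<close>. The variable \<open>y\<close> makes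
  it satisfy a functional equation; the value needed is the one at \<open>y = 1\<close>.
\<close>

definition euler_series :: "real \<Rightarrow> real \<Rightarrow> real" where
  "euler_series q y = (\<Sum>k. (-1) ^ k / q_denom q k * y ^ k)"

text \<open>
  In the difference of the series at \<open>y\<close> and \<open>y / q\<close>, the coefficient of index \<open>k + 1\<close> acquires the
  factor \<open>q ^ (k + 1) - 1\<close>, which cancels the last factor of its denominator and reproduces the series
  with its index shifted by one.
\<close>

lemma euler_series_rec:
  assumes "2 \<le> q" "\<bar>y\<bar> \<le> 1"
  shows "euler_series q y = (1 - y / q) * euler_series q (y / q)"
proof -
  let ?c = "\<lambda>k. (-1) ^ k / q_denom q k"
  have "\<bar>y\<bar> \<le> q" using assms by linarith
  then have y: "\<bar>y / q\<bar> \<le> 1" using assms by (simp add: field_simps)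
  note s1 = euler_summable[OF assms] and s2 = euler_summable[OF assms(1) y]
  let ?d = "\<lambda>k. ?c k * y ^ k - ?c k * (y / q) ^ k"
  have d: "?d (Suc k) = - (y / q) * (?c k * (y / q) ^ k)" for k
  proof -
    define e where "e = q ^ Suc k - 1"
    have "1 < q ^ Suc k" using assms by (intro one_less_power) auto
    then have e: "e \<noteq> 0" by (simp add: e_def)
    have "y ^ Suc k = (e + 1) * (y / q) ^ Suc k"
      using assms by (simp add: e_def power_divide)
    moreover have "c * ((e + 1) * z) - c * z = c * e * z" for c z
      by (simp add: algebra_simps)
    ultimately have "?d (Suc k) = ?c (Suc k) * e * (y / q) ^ Suc k"
      by (simp only:)
    also have "?c (Suc k) * e = - ?c k"
      using e unfolding q_denom_Suc e_def[symmetric] by simp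
    also have "- ?c k * (y / q) ^ Suc k = - (y / q) * (?c k * (y / q) ^ k)"
      by (simp only: power_Suc mult_ac mult_minus_left mult_minus_right)
    finally show ?thesis .
  qed
  have "euler_series q y - euler_series q (y / q) = (\<Sum>k. ?d k)"
    unfolding euler_series_def using suminf_diff[OF s1 s2] by simp
  also have "\<dots> = (\<Sum>k. ?d (Suc k))"
    using suminf_split_head[OF summable_diff[OF s1 s2]] by simp
  also have "\<dots> = - (y / q) * euler_series q (y / q)"
    unfolding d euler_series_def by (rule suminf_mult[OF s2])
  finally show ?thesis by (simp add: algebra_simps)
qed

lemma euler_series_one:
  assumes "2 \<le> q"
  shows "euler_series q 1 = (\<Prod>r<m. 1 - 1 / q ^ Suc r) * euler_series q (1 / q ^ m)"
proof (induction m)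
  case 0
  show ?case by simp
next
  case (Suc m)
  have "\<bar>1 / q ^ m\<bar> \<le> 1" using assms by (simp add: one_le_power)
  from euler_series_rec[OF assms this] Suc show ?case by (simp add: mult.commute)
qed

text \<open>
  Iterating the functional equation splits off the partial products, and the remaining value of the
  series at \<open>1 / q ^ m\<close> tends to its constant term \<open>1\<close> by continuity at zero.
\<close>

lemma euler_product_tendsto:
  assumes "2 \<le> q"
  shows "(\<lambda>m. \<Prod>r<m. 1 - 1 / q ^ Suc r) \<longlonglongrightarrow> euler_series q 1"
proof -
  have "isCont (euler_series q) 0"
    unfolding euler_series_def [abs_def]
    by (rule isCont_powser[where K = 1]) (use euler_summable[OF assms, of 1] in simp_all)
  moreover have "(\<lambda>m. 1 / q ^ m) \<longlonglongrightarrow> 0"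
    using LIMSEQ_inverse_realpow_zero[of q] assms by (simp add: inverse_eq_divide)
  ultimately have "(\<lambda>m. euler_series q (1 / q ^ m)) \<longlonglongrightarrow> euler_series q 0"
    by (rule isCont_tendsto_compose)
  moreover have "euler_series q 0 = 1"
    unfolding euler_series_def powser_zero by (simp add: q_denom_0)
  ultimately have lim: "(\<lambda>m. euler_series q (1 / q ^ m)) \<longlonglongrightarrow> 1" by simp
  then have "(\<lambda>m. euler_series q 1 / euler_series q (1 / q ^ m)) \<longlonglongrightarrow> euler_series q 1 / 1"
    by (intro tendsto_divide tendsto_const) simp_all
  moreover have "eventually (\<lambda>m. euler_series q (1 / q ^ m) \<noteq> 0) sequentially"
    using lim by (rule tendsto_imp_eventually_ne) simp
  then have "eventually (\<lambda>m. euler_series q 1 / euler_series q (1 / q ^ m) = (\<Prod>r<m. 1 - 1 / q ^ Suc r)) sequentially"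
  proof (rule eventually_mono)
    fix m assume "euler_series q (1 / q ^ m) \<noteq> 0"
    then show "euler_series q 1 / euler_series q (1 / q ^ m) = (\<Prod>r<m. 1 - 1 / q ^ Suc r)"
      by (simp only: euler_series_one[OF assms, of m] nonzero_mult_div_cancel_right not_False_eq_True)
  qed
  ultimately have "(\<lambda>m. \<Prod>r<m. 1 - 1 / q ^ Suc r) \<longlonglongrightarrow> euler_series q 1 / 1"
    by (rule Lim_transform_eventually)
  then show ?thesis by simp
qed

lemma convergent_prod_euler:
  assumes "2 \<le> (q::real)"
  shows "convergent_prod (\<lambda>r. 1 - 1 / q ^ Suc r)"
proof -
  have "summable (\<lambda>r. (1 / q) ^ Suc r)"
    using assms by (subst summable_Suc_iff) (simp add: summable_geometric)
  then have "abs_convergent_prod (\<lambda>r. 1 - 1 / q ^ Suc r)"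
    using assms by (intro summable_imp_abs_convergent_prod) (simp add: power_divide power_abs)
  then show ?thesis by (rule abs_convergent_prod_imp_convergent_prod)
qed

text \<open>
  Columns chosen one at a time give the product of the numbers \<open>q ^ n - q ^ i\<close>; dividing each factor by
  \<open>q ^ n\<close> and reversing the order leaves the initial factors of the infinite product.
\<close>

lemma card_GL:
  "real (card (GL n :: 'a :: {field, finite} mat set)) =
    real CARD('a) ^ n\<^sup>2 * (\<Prod>r<n. 1 - 1 / real CARD('a) ^ Suc r)"
proof -
  let ?q = "real CARD('a)"
  have q: "?q \<noteq> 0" by simp
  have "?q ^ n - ?q ^ i = ?q ^ n * (1 - 1 / ?q ^ Suc (n - Suc i))" if "i < n" for i
  proof -
    have "?q ^ n = ?q ^ i * ?q ^ Suc (n - Suc i)"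
      using that by (simp only: power_add [symmetric]) simp
    then show ?thesis using q by (simp add: right_diff_distrib del: power_Suc)
  qed
  then have "(\<Prod>i<n. ?q ^ n - ?q ^ i) = (\<Prod>i<n. ?q ^ n * (1 - 1 / ?q ^ Suc (n - Suc i)))"
    by (intro prod.cong) simp_all
  also have "\<dots> = (?q ^ n) ^ n * (\<Prod>i<n. 1 - 1 / ?q ^ Suc (n - Suc i))"
    by (simp only: prod.distrib prod_constant card_lessThan)
  also have "(?q ^ n) ^ n = ?q ^ n\<^sup>2"
    by (simp only: power_mult[symmetric] power2_eq_square)
  also have "(\<Prod>i<n. 1 - 1 / ?q ^ Suc (n - Suc i)) = (\<Prod>r<n. 1 - 1 / ?q ^ Suc r)"
    by (rule prod.nat_diff_reindex)
  finally show ?thesis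
    using card_injective_mats[where 'a = 'a, of n n] by (simp only: injective_mats_square_eq_GL)
qed

theorem corollary11:
  fixes q :: nat
  assumes "primepow q"
    and "CARD('a :: {field, finite}) = q"
  shows "(\<lambda>n. real (card (linear_derangements n :: 'a mat set)) / real (card (GL n :: 'a mat set)))
           \<longlonglongrightarrow> (\<Prod>r. 1 - 1 / real q ^ Suc r) \<and>
         (\<lambda>n. real (card (linear_derangements n :: 'a mat set)) / real q ^ (n\<^sup>2))
           \<longlonglongrightarrow> (\<Prod>r. (1 - 1 / real q ^ Suc r)\<^sup>2)"
proof -
  let ?f = "\<lambda>r. 1 - 1 / real q ^ Suc r" and ?S = "\<lambda>n. \<Sum>k\<le>n. (-1) ^ k / q_denom (real q) k"
  have q: "2 \<le> real q" using card_field_gt_1[where 'a = 'a] assms(2) by simp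
  have conv: "convergent_prod ?f" using q by (rule convergent_prod_euler)
  have partial: "(\<lambda>n. \<Prod>r<n. ?f r) \<longlonglongrightarrow> prodinf ?f"
    using convergent_prod_LIMSEQ[OF conv] LIMSEQ_lessThan_iff_atMost[of "prod ?f"] by simp
  then have euler: "prodinf ?f = euler_series (real q) 1"
    using euler_product_tendsto[OF q] by (rule LIMSEQ_unique)
  have series: "?S \<longlonglongrightarrow> prodinf ?f"
    unfolding euler euler_series_def
    using summable_LIMSEQ'[OF euler_summable[OF q, of 1]] by simp
  have pos: "?f r \<noteq> 0" for r using one_less_power[of "real q" "Suc r"] q by simp
  have "card (GL n :: 'a mat set) \<noteq> 0" for n
  proof -
    have "real (card (GL n :: 'a mat set)) \<noteq> 0"
      unfolding card_GL assms(2) using pos q by (simp add: prod_zero_iff del: power_Suc)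
    then show ?thesis by simp
  qed
  then have ratio: "real (card (linear_derangements n :: 'a mat set)) / real (card (GL n :: 'a mat set)) = ?S n" for n
    unfolding card_linear_derangements assms(2) by simp
  have density: "real (card (linear_derangements n :: 'a mat set)) / real q ^ n\<^sup>2 = (\<Prod>r<n. ?f r) * ?S n" for n
    unfolding card_linear_derangements card_GL assms(2) using q by simp
  have "?f has_prod prodinf ?f" using conv by (rule convergent_prod_has_prod)
  moreover have "prodinf ?f \<noteq> 0" using conv pos by (rule prodinf_nonzero)
  ultimately have "(\<lambda>r. ?f r * ?f r) has_prod (prodinf ?f * prodinf ?f)"
    by (intro has_prod_mult_nz)
  then have square: "(\<Prod>r. (?f r)\<^sup>2) = prodinf ?f * prodinf ?f"
    unfolding power2_eq_square by (rule has_prod_unique[symmetric])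
  show ?thesis
    unfolding ratio density square using series tendsto_mult[OF partial series] by blast
qed

end
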